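(* Suppose that for every $x\in M$ and every $\delta>0$ there exists a function $\varphi_x\in\mathrm{C}_0$ satisfying the following: (i) $\varphi_x(x)=1$ and $0\le\varphi_x\le1$; (ii) $\varphi_x\in\bigcap_{\lambda\in\Lambda}D(A_\lambda)$ with $\sup_{\lambda\in\Lambda}\|A_\lambda\varphi_x\|_\kappa\le\delta$. Then the semigroup envelope $\mathscr{S}$ is continuous from above on $\mathrm{Lip}_{\rm b}$.
   Context: Setting: $\Lambda$ is a nonempty set, $(M,d)$ is a separable metric space, and $\kappa\colon M\to(0,\infty)$ is continuous and bounded. $\|u\|_\infty=\sup_{x\in M}|u(x)|$; $\|u\|_\kappa=\|\kappa u\|_\infty$; $\|u\|_{\mathrm{Lip}}=\inf\{L\ge 0: |u(x)-u(y)|\le L d(x,y)\ \forall x,y\in M\}$. $\mathrm{C}_\kappa$ is the space of continuous $u\colon M\to\mathbb{R}$ with $\|u\|_\kappa<\infty$; $\mathrm{Lip}_{\rm b}$ is the space of bounded Lipschitz functions $M\to\mathbb{R}$; $\mathrm{UC}_\kappa$ is the closure of $\mathrm{Lip}_{\rm b}$ in $(\mathrm{C}_\kappa,\|\cdot\|_\kappa)$; $\mathrm{C}_0$ is the closure w.r.t. $\|\cdot\|_\infty$ of the space of continuous functions $M\to\mathbb{R}$ with compact support, equivalently of the Lipschitz functions with compact support, and $\mathrm{C}_0\subset\mathrm{UC}_\kappa$. Order between functions is pointwise; $u_n\nearrow u$ (resp. $u_n\searrow u$) means pointwise nondecreasing (resp. nonincreasing) pointwise convergence. A Feller semigroup is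 a family $T=(T(t))_{t\ge0}$ of possibly nonlinear operators such that (i) $T(t)\colon\mathrm{UC}_\kappa\to\mathrm{UC}_\kappa$ is ($\|\cdot\|_\kappa$-)continuous for all $t\ge 0$; (ii) $T(0)u=u$ and $T(s+t)u=T(s)T(t)u$ for all $s,t\ge0$, $u\in\mathrm{UC}_\kappa$; (iii) each $T(t)$ is monotone and continuous from below, i.e. $u_n\nearrow u$ in $\mathrm{UC}_\kappa$ implies $T(t)u_n\nearrow T(t)u$. Standing assumptions: (A1) for every $\lambda\in\Lambda$, $S_\lambda=(S_\lambda(t))_{t\ge0}$ is a Feller semigroup of linear operators with $S_\lambda(t)1=1$ for all $t\geq 0$; (A2) there are $\alpha,\beta\in\mathbb{R}$ with $\|S_\lambda(t)u\|_\kappa\le e^{\alpha t}\|u\|_\kappa$ and $\|S_\lambda(t)u\|_{\mathrm{Lip}}\le e^{\beta t}\|u\|_{\mathrm{Lip}}$ for all $u\in\mathrm{Lip}_{\rm b}$, $\lambda\in\Lambda$, $t\ge0$. $D(A_\lambda)$ is the space of $u\in\mathrm{UC}_\kappa$ for which $A_\lambda u:=\lim_{h\searrow0}\frac{S_\lambda(h)u-u}{h}\in\mathrm{UC}_\kappa$ exists w.r.t. $\|\cdot\|_\kappa$. For $h\ge0$, $u\in\mathrm{UC}_\kappa$: $(\mathcal{E}_hu)(x)=\sup_{\lambda\in\Lambda}(S_\lambda(h)u)(x)$; $\mathcal{E}_h$ maps $\mathrm{UC}_\kappa$ to itself. $P$ is the set of finite subsets $\pi\subset[0,\infty)$ with $0\in\pi$,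 and $P_t=\{\pi\in P:\max\pi=t\}$. For $\pi=\{t_0,\dots,t_m\}$ with $0=t_0<t_1<\dots<t_m$, $m\ge 1$, $\mathcal{E}_\pi u=\mathcal{E}_{t_1-t_0}\cdots\mathcal{E}_{t_m-t_{m-1}}u$ (composition), and $\mathcal{E}_{\{0\}}u=u$. The semigroup envelope $\mathscr{S}=(\mathscr{S}(t))_{t\ge0}$ is $(\mathscr{S}(t)u)(x)=\sup_{\pi\in P_t}(\mathcal{E}_\pi u)(x)$ for $t\ge0$, $u\in\mathrm{UC}_\kappa$, $x\in M$; it is a Feller semigroup. For a linear space $L\subset\mathrm{UC}_\kappa$, $\mathscr{S}$ is continuous from above on $L$ if $\mathscr{S}(t)u_n\searrow0$ for all $t\ge0$ and all $(u_n)_{n\in\mathbb{N}}\subset L$ with $u_n\searrow0$ as $n\to\infty$. *)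

theory Defs
  imports "HOL-Analysis.Analysis"
begin

text \<open>
  Real-valued functions on M are plain functions on a metric space type; the function spaces are
  sets of such functions, and operators are only constrained on these sets. Norms are extended
  reals, so that they are meaningful (possibly infinite) for every function.
\<close>

definition sup_norm :: "('m \<Rightarrow> real) \<Rightarrow> ereal" where
  "sup_norm u = (SUP x. ereal \<bar>u x\<bar>)"

definition wnorm :: "('m \<Rightarrow> real) \<Rightarrow> ('m \<Rightarrow> real) \<Rightarrow> ereal" where
  "wnorm \<kappa> u = sup_norm (\<lambda>x. \<kappa> x * u x)"

text \<open>The infimum of the empty set is \<open>\<infinity>\<close>, the value for functions that are not Lipschitz.\<close>

definition lip_norm :: "('m::metric_space \<Rightarrow> real) \<Rightarrow> ereal" where
  "lip_norm u = (INF L\<in>{L. L-lipschitz_on UNIV u}. ereal L)"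

definition C_wt :: "('m::metric_space \<Rightarrow> real) \<Rightarrow> ('m \<Rightarrow> real) set" where
  "C_wt \<kappa> = {u. continuous_on UNIV u \<and> wnorm \<kappa> u < \<infinity>}"

definition Lip_b :: "('m::metric_space \<Rightarrow> real) set" where
  "Lip_b = {u. bounded (range u) \<and> (\<exists>L. L-lipschitz_on UNIV u)}"

definition UC_wt :: "('m::metric_space \<Rightarrow> real) \<Rightarrow> ('m \<Rightarrow> real) set" where
  "UC_wt \<kappa> = {u \<in> C_wt \<kappa>. \<forall>\<epsilon>>0. \<exists>v\<in>Lip_b. wnorm \<kappa> (\<lambda>x. u x - v x) < ereal \<epsilon>}"

definition C_c :: "('m::metric_space \<Rightarrow> real) set" where
  "C_c = {u. continuous_on UNIV u \<and> compact (closure {x. u x \<noteq> 0})}"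

text \<open>Uniform limits of continuous functions are continuous, so continuity is not required here.\<close>

definition C_0 :: "('m::metric_space \<Rightarrow> real) set" where
  "C_0 = {u. \<forall>\<epsilon>>0. \<exists>v\<in>C_c. sup_norm (\<lambda>x. u x - v x) < ereal \<epsilon>}"

definition increases_to :: "(nat \<Rightarrow> 'm \<Rightarrow> real) \<Rightarrow> ('m \<Rightarrow> real) \<Rightarrow> bool" where
  "increases_to us u \<longleftrightarrow> (\<forall>x. incseq (\<lambda>n. us n x) \<and> (\<lambda>n. us n x) \<longlonglongrightarrow> u x)"

definition decreases_to :: "(nat \<Rightarrow> 'm \<Rightarrow> real) \<Rightarrow> ('m \<Rightarrow> real) \<Rightarrow> bool" where
  "decreases_to us u \<longleftrightarrow> (\<forall>x. decseq (\<lambda>n. us n x) \<and> (\<lambda>n. us n x) \<longlonglongrightarrow> u x)"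

type_synonym 'm op_family = "real \<Rightarrow> ('m \<Rightarrow> real) \<Rightarrow> ('m \<Rightarrow> real)"

definition wnorm_continuous ::
    "('m::metric_space \<Rightarrow> real) \<Rightarrow> (('m \<Rightarrow> real) \<Rightarrow> ('m \<Rightarrow> real)) \<Rightarrow> bool" where
  "wnorm_continuous \<kappa> F \<longleftrightarrow>
     (\<forall>u\<in>UC_wt \<kappa>. \<forall>\<epsilon>>0. \<exists>\<delta>>0. \<forall>v\<in>UC_wt \<kappa>.
        wnorm \<kappa> (\<lambda>x. v x - u x) < ereal \<delta> \<longrightarrow> wnorm \<kappa> (\<lambda>x. F v x - F u x) < ereal \<epsilon>)"

definition feller_semigroup :: "('m::metric_space \<Rightarrow> real) \<Rightarrow> 'm op_family \<Rightarrow> bool" where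
  "feller_semigroup \<kappa> T \<longleftrightarrow>
     (\<forall>t\<ge>0. \<forall>u\<in>UC_wt \<kappa>. T t u \<in> UC_wt \<kappa>) \<and>
     (\<forall>t\<ge>0. wnorm_continuous \<kappa> (T t)) \<and>
     (\<forall>u\<in>UC_wt \<kappa>. T 0 u = u) \<and>
     (\<forall>s\<ge>0. \<forall>t\<ge>0. \<forall>u\<in>UC_wt \<kappa>. T (s + t) u = T s (T t u)) \<and>
     (\<forall>t\<ge>0. \<forall>u\<in>UC_wt \<kappa>. \<forall>v\<in>UC_wt \<kappa>. (\<forall>x. u x \<le> v x) \<longrightarrow> (\<forall>x. T t u x \<le> T t v x)) \<and>
     (\<forall>t\<ge>0. \<forall>us. \<forall>u\<in>UC_wt \<kappa>. (\<forall>n. us n \<in> UC_wt \<kappa>) \<longrightarrow> increases_to us u \<longrightarrow>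
        increases_to (\<lambda>n. T t (us n)) (T t u))"

definition linear_family :: "('m::metric_space \<Rightarrow> real) \<Rightarrow> 'm op_family \<Rightarrow> bool" where
  "linear_family \<kappa> T \<longleftrightarrow>
     (\<forall>t\<ge>0. \<forall>u\<in>UC_wt \<kappa>. \<forall>v\<in>UC_wt \<kappa>. \<forall>a b.
        T t (\<lambda>x. a * u x + b * v x) = (\<lambda>x. a * T t u x + b * T t v x))"

definition has_generator_value ::
    "('m::metric_space \<Rightarrow> real) \<Rightarrow> 'm op_family \<Rightarrow> ('m \<Rightarrow> real) \<Rightarrow> ('m \<Rightarrow> real) \<Rightarrow> bool" where
  "has_generator_value \<kappa> T u v \<longleftrightarrow>
     v \<in> UC_wt \<kappa> \<and> ((\<lambda>h. wnorm \<kappa> (\<lambda>x. (T h u x - u x) / h - v x)) \<longlongrightarrow> 0) (at_right 0)"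

definition gen_domain ::
    "('m::metric_space \<Rightarrow> real) \<Rightarrow> 'm op_family \<Rightarrow> ('m \<Rightarrow> real) set" where
  "gen_domain \<kappa> T = {u \<in> UC_wt \<kappa>. \<exists>v. has_generator_value \<kappa> T u v}"

text \<open>The limit is unique because \<open>\<kappa>\<close> is strictly positive.\<close>

definition generator ::
    "('m::metric_space \<Rightarrow> real) \<Rightarrow> 'm op_family \<Rightarrow> ('m \<Rightarrow> real) \<Rightarrow> ('m \<Rightarrow> real)" where
  "generator \<kappa> T u = (THE v. has_generator_value \<kappa> T u v)"

definition sup_op :: "'l set \<Rightarrow> ('l \<Rightarrow> 'm op_family) \<Rightarrow> 'm op_family" where
  "sup_op \<Lambda> S h u = (\<lambda>x. SUP l\<in>\<Lambda>. S l h u x)"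

definition partitions :: "real \<Rightarrow> real set set" where
  "partitions t = {\<pi>. finite \<pi> \<and> \<pi> \<subseteq> {0..} \<and> 0 \<in> \<pi> \<and> Max \<pi> = t}"

fun compose_along ::
    "'m op_family \<Rightarrow> real list \<Rightarrow> ('m \<Rightarrow> real) \<Rightarrow> ('m \<Rightarrow> real)" where
  "compose_along E (s # t # ts) u = E (t - s) (compose_along E (t # ts) u)"
| "compose_along E [s] u = u"
| "compose_along E [] u = u"

definition partition_op ::
    "'l set \<Rightarrow> ('l \<Rightarrow> 'm op_family) \<Rightarrow> real set \<Rightarrow> ('m \<Rightarrow> real) \<Rightarrow> ('m \<Rightarrow> real)" where
  "partition_op \<Lambda> S \<pi> u = compose_along (sup_op \<Lambda> S) (sorted_list_of_set \<pi>) u"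

definition semigroup_envelope :: "'l set \<Rightarrow> ('l \<Rightarrow> 'm op_family) \<Rightarrow> 'm op_family" where
  "semigroup_envelope \<Lambda> S t u = (\<lambda>x. SUP \<pi>\<in>partitions t. partition_op \<Lambda> S \<pi> u x)"

definition continuous_from_above_on :: "('m \<Rightarrow> real) set \<Rightarrow> 'm op_family \<Rightarrow> bool" where
  "continuous_from_above_on L T \<longleftrightarrow>
     (\<forall>t\<ge>0. \<forall>us. (\<forall>n. us n \<in> L) \<longrightarrow> decreases_to us (\<lambda>x. 0) \<longrightarrow>
        decreases_to (\<lambda>n. T t (us n)) (\<lambda>x. 0))"

end

theory Submission
  imports Defs
begin

text \<open>
  Let \<open>us n\<close> decrease to zero in \<^term>\<open>Lip_b\<close>, with \<open>us 0 \<le> C\<close>, and fix a point \<open>x\<close>. The idea is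
  to trap the functions \<open>us n\<close>, for large \<open>n\<close>, below one barrier
  \<open>w = \<epsilon> + 2 C (1 - \<phi>)\<close> that has the small value \<open>\<epsilon>\<close> at \<open>x\<close> and that the envelope
  hardly moves. Here \<open>\<phi>\<close> is a test function at \<open>x\<close>. On the compact set where \<open>\<phi> \<ge> 1/2\<close>,
  Dini's theorem makes \<open>us n\<close> smaller than \<open>\<epsilon>\<close> (\<open>C_0_superlevel_compact\<close>,
  \<open>Dini_decreasing\<close>); off this set \<open>2 C (1 - \<phi>) \<ge> C \<ge> us n\<close>. So \<open>us n \<le> w\<close>.

  Constants are fixed by the linear semigroups, so \<open>S l h w - w = - 2 C (S l h \<phi> - \<phi>)\<close>, and a bound
  on the generator by \<open>\<delta>\<close> bounds this, in the weighted norm, by a multiple of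
  \<open>\<delta> h exp (\<bar>\<alpha>\<bar> h)\<close> uniformly in \<open>l\<close> (\<open>S_deviation\<close>). In the weighted norm every \<open>S l h\<close> enlarges
  an error by at most \<open>exp (\<alpha> h)\<close> (\<open>S_growth\<close>), so the errors made along a partition of
  \<open>[0, t]\<close> add up to a multiple of \<open>\<delta> t exp (\<bar>\<alpha>\<bar> t)\<close>, whatever the partition
  (\<open>iterate_deviation\<close>). Taking the supremum over partitions, the envelope of \<open>us n\<close> at \<open>x\<close> is at
  most \<open>\<epsilon>\<close> plus a multiple of \<open>\<delta>\<close> whose factor depends on \<open>x\<close>, \<open>t\<close> and \<open>C\<close> only, and
  \<open>\<epsilon>\<close> and \<open>\<delta>\<close> can be chosen as small as desired.

  All suprema are suprema of real numbers, which mean something only for sets that are bounded above.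
  The iterates are therefore applied to bounded Lipschitz functions only, a class that the one-step
  supremum preserves (\<open>sup_op_Lip_b\<close>); the barrier itself, which is only in the larger space
  \<^term>\<open>UC_wt \<kappa>\<close>, is fed to the linear semigroups but never to the suprema.
\<close>

section \<open>Weighted norms and function spaces\<close>

lemma Lip_bI:
  assumes "\<And>x. \<bar>u x\<bar> \<le> C" "L-lipschitz_on UNIV u"
  shows "u \<in> Lip_b"
  using assms unfolding Lip_b_def by (auto simp: bounded_iff)

lemma Lip_b_bound:
  assumes "u \<in> Lip_b"
  obtains C where "0 < C" "\<And>x. \<bar>u x\<bar> \<le> C"
  using assms unfolding Lip_b_def by (auto simp: bounded_pos)

lemma Lip_b_lipschitz:
  assumes "u \<in> Lip_b"
  obtains L where "0 \<le> L" "L-lipschitz_on UNIV u"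
  using assms lipschitz_on_nonneg unfolding Lip_b_def by blast

lemma Lip_b_continuous: "u \<in> Lip_b \<Longrightarrow> continuous_on UNIV u"
  unfolding Lip_b_def by (auto intro: lipschitz_on_continuous_on)

lemma Lip_b_const: "(\<lambda>x. c) \<in> Lip_b"
  by (rule Lip_bI[of _ "\<bar>c\<bar>" 0]) (auto simp: lipschitz_on_def)

lemma Lip_b_linear:
  assumes "u \<in> Lip_b" "v \<in> Lip_b"
  shows "(\<lambda>x. a * u x + b * v x) \<in> Lip_b"
proof -
  obtain C D where C: "\<And>x. \<bar>u x\<bar> \<le> C" and D: "\<And>x. \<bar>v x\<bar> \<le> D"
    using Lip_b_bound assms by metis
  obtain K L where K: "K-lipschitz_on UNIV u" and L: "L-lipschitz_on UNIV v"
    using Lip_b_lipschitz assms by metis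
  have "(\<bar>a\<bar> * K + \<bar>b\<bar> * L)-lipschitz_on UNIV (\<lambda>x. a * u x + b * v x)"
    using K L by (intro lipschitz_on_add lipschitz_on_cmult_real)
  moreover have "\<bar>a * u x + b * v x\<bar> \<le> \<bar>a\<bar> * C + \<bar>b\<bar> * D" for x
    by (rule order_trans[OF abs_triangle_ineq])
      (auto simp: abs_mult intro!: add_mono mult_left_mono C D)
  ultimately show ?thesis by (rule Lip_bI[rotated])
qed

lemma Lip_b_pos_part:
  assumes "u \<in> Lip_b"
  shows "(\<lambda>x. max 0 (u x)) \<in> Lip_b"
proof -
  obtain C where C: "\<And>x. \<bar>u x\<bar> \<le> C" using Lip_b_bound assms by metis
  obtain L where L: "L-lipschitz_on UNIV u" using Lip_b_lipschitz assms by metis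
  have "\<bar>max 0 (u x)\<bar> \<le> C" for x using C[of x] by linarith
  moreover have "L-lipschitz_on UNIV (\<lambda>x. max 0 (u x))"
  proof (rule lipschitz_onI)
    show "0 \<le> L" using L by (rule lipschitz_on_nonneg)
    fix x y
    show "dist (max 0 (u x)) (max 0 (u y)) \<le> L * dist x y"
      using lipschitz_onD[OF L, of x y] by (simp add: dist_real_def)
  qed
  ultimately show ?thesis by (rule Lip_bI)
qed

lemma lipschitz_on_lip_norm_less:
  assumes "lip_norm u < ereal L"
  shows "L-lipschitz_on UNIV u"
proof -
  obtain K where "K-lipschitz_on UNIV u" "K < L"
    using assms unfolding lip_norm_def by (auto simp: INF_less_iff)
  then show ?thesis by (meson less_imp_le lipschitz_on_le)
qed

lemma sup_norm_lessD:
  assumes "sup_norm u < ereal c"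
  shows "\<bar>u x\<bar> < c"
proof -
  have "ereal \<bar>u x\<bar> \<le> sup_norm u" unfolding sup_norm_def by (rule SUP_upper) simp
  then show ?thesis using assms by (metis ereal_less_eq(3) le_less_trans less_ereal.simps(1))
qed

text \<open>
  A compactly supported function within \<open>c\<close> of \<open>\<phi>\<close> cannot vanish where \<open>\<phi> \<ge> c\<close>, so the
  superlevel set is a closed subset of its support.
\<close>

lemma C_0_superlevel_compact:
  assumes "\<phi> \<in> C_0" "continuous_on UNIV \<phi>" "0 < c"
  shows "compact {x. c \<le> \<phi> x}"
proof -
  obtain v where v: "v \<in> C_c" "sup_norm (\<lambda>x. \<phi> x - v x) < ereal c"
    using assms unfolding C_0_def by blast
  have "{x. c \<le> \<phi> x} \<subseteq> {x. v x \<noteq> 0}"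
  proof
    fix x assume "x \<in> {x. c \<le> \<phi> x}"
    then show "x \<in> {x. v x \<noteq> 0}" using sup_norm_lessD[OF v(2), of x] by auto
  qed
  then have "{x. c \<le> \<phi> x} \<subseteq> closure {x. v x \<noteq> 0}"
    using closure_subset by blast
  moreover have "compact (closure {x. v x \<noteq> 0})" using v(1) unfolding C_c_def by simp
  moreover have "closed {x. c \<le> \<phi> x}"
    by (rule closed_Collect_le) (use assms in auto)
  ultimately show ?thesis by (metis compact_Int_closed inf.absorb_iff2)
qed

lemma decreases_to_zero_nonneg:
  assumes "decreases_to us (\<lambda>x. 0)"
  shows "0 \<le> us n x"
  using assms decseq_ge unfolding decreases_to_def by metis

text \<open>
  The sets where \<open>us n\<close> is below \<open>\<epsilon>\<close> are open, grow with \<open>n\<close> and cover \<open>K\<close>; one of them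
  covers the compact set alone.
\<close>

lemma Dini_decreasing:
  fixes us :: "nat \<Rightarrow> 'm::topological_space \<Rightarrow> real"
  assumes K: "compact K" and cont: "\<And>n. continuous_on UNIV (us n)"
    and dec: "decreases_to us (\<lambda>x. 0)" and "0 < \<epsilon>"
  obtains N where "\<And>n x. N \<le> n \<Longrightarrow> x \<in> K \<Longrightarrow> us n x < \<epsilon>"
proof -
  let ?U = "\<lambda>n. {x. us n x < \<epsilon>}"
  have anti: "us n x \<le> us m x" if "m \<le> n" for m n x
    using dec that unfolding decreases_to_def decseq_def by blast
  have "open (?U n)" for n by (rule open_Collect_less) (use cont in auto)
  moreover have "K \<subseteq> (\<Union>n. ?U n)"
  proof
    fix x
    have "(\<lambda>n. us n x) \<longlonglongrightarrow> 0" using dec unfolding decreases_to_def by blast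
    then have "\<forall>\<^sub>F n in sequentially. us n x < \<epsilon>" using \<open>0 < \<epsilon>\<close> by (rule order_tendstoD)
    then show "x \<in> (\<Union>n. ?U n)" by (auto simp: eventually_sequentially)
  qed
  ultimately obtain I where I: "finite I" "K \<subseteq> (\<Union>n\<in>I. ?U n)"
    using compactE_image[OF K, of UNIV ?U] by auto
  have "us n x < \<epsilon>" if n: "Max (insert 0 I) \<le> n" "x \<in> K" for n x
  proof -
    obtain m where "m \<in> I" "us m x < \<epsilon>" using I(2) n(2) by auto
    moreover have "m \<le> n" using \<open>m \<in> I\<close> I(1) n(1) by simp
    ultimately show ?thesis using anti[of m n x] by linarith
  qed
  then show thesis by (rule that)
qed

locale bounded_weight =
  fixes \<kappa> :: "'m::metric_space \<Rightarrow> real"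
  assumes kappa_pos: "0 < \<kappa> x"
    and kappa_bounded: "bounded (range \<kappa>)"
begin

lemma wnorm_le_iff: "wnorm \<kappa> u \<le> ereal c \<longleftrightarrow> (\<forall>x. \<kappa> x * \<bar>u x\<bar> \<le> c)"
  using kappa_pos by (auto simp: wnorm_def sup_norm_def SUP_le_iff abs_mult less_imp_le)

lemma wnorm_lessD: "wnorm \<kappa> u < ereal c \<Longrightarrow> \<kappa> x * \<bar>u x\<bar> \<le> c"
  using wnorm_le_iff less_imp_le by blast

lemma wnorm_lessI:
  assumes "\<And>x. \<kappa> x * \<bar>u x\<bar> \<le> c" "c < d"
  shows "wnorm \<kappa> u < ereal d"
  using assms wnorm_le_iff[of u c] by (meson le_less_trans less_ereal.simps(1))

lemma kappa_le:
  obtains R where "0 < R" "\<And>x. \<kappa> x \<le> R"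
  using kappa_bounded kappa_pos unfolding bounded_pos
  by (metis abs_le_D1 rangeI real_norm_def)

text \<open>
  A form with real inequalities only. The norm of \<open>u\<close> is automatically finite, because \<open>u\<close> is at
  distance at most 1 from a bounded function and the weight is bounded.
\<close>

lemma UC_wt_iff:
  "u \<in> UC_wt \<kappa> \<longleftrightarrow>
    continuous_on UNIV u \<and> (\<forall>\<epsilon>>0. \<exists>v\<in>Lip_b. \<forall>x. \<kappa> x * \<bar>u x - v x\<bar> \<le> \<epsilon>)"
  (is "_ \<longleftrightarrow> ?R")
proof
  assume "u \<in> UC_wt \<kappa>"
  then show ?R unfolding UC_wt_def C_wt_def by (auto dest: wnorm_lessD) (meson wnorm_lessD)
next
  assume R: ?R
  have dense: "\<exists>v\<in>Lip_b. wnorm \<kappa> (\<lambda>x. u x - v x) < ereal \<epsilon>" if \<epsilon>: "0 < \<epsilon>" for \<epsilon>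
  proof -
    obtain v where "v \<in> Lip_b" "\<And>x. \<kappa> x * \<bar>u x - v x\<bar> \<le> \<epsilon> / 2"
      using R half_gt_zero[OF \<epsilon>] by blast
    then show ?thesis using \<epsilon> by (intro bexI[of _ v] wnorm_lessI[of _ "\<epsilon> / 2"]) auto
  qed
  obtain v where v: "v \<in> Lip_b" "\<And>x. \<kappa> x * \<bar>u x - v x\<bar> \<le> 1" using R by (metis zero_less_one)
  obtain C where C: "0 < C" "\<And>x. \<bar>v x\<bar> \<le> C" using Lip_b_bound v(1) by metis
  obtain B where B: "0 < B" "\<And>x. \<kappa> x \<le> B" using kappa_le by metis
  have "\<kappa> x * \<bar>u x\<bar> \<le> 1 + B * C" for x
  proof -
    have "\<kappa> x * \<bar>u x\<bar> \<le> \<kappa> x * (\<bar>u x - v x\<bar> + \<bar>v x\<bar>)"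
      using kappa_pos[of x] by (intro mult_left_mono) auto
    moreover have "\<kappa> x * \<bar>v x\<bar> \<le> B * C"
      using B C kappa_pos[of x] by (intro mult_mono) auto
    ultimately show ?thesis using v(2)[of x] by (simp add: distrib_left)
  qed
  then have "wnorm \<kappa> u < ereal (2 + B * C)" by (rule wnorm_lessI) simp
  then have "wnorm \<kappa> u < \<infinity>" by auto
  then show "u \<in> UC_wt \<kappa>" using R dense unfolding UC_wt_def C_wt_def by simp
qed

lemma UC_wt_continuous: "u \<in> UC_wt \<kappa> \<Longrightarrow> continuous_on UNIV u"
  by (simp add: UC_wt_iff)

lemma Lip_b_subset_UC_wt: "u \<in> Lip_b \<Longrightarrow> u \<in> UC_wt \<kappa>"
  unfolding UC_wt_iff by (auto intro!: Lip_b_continuous bexI[of _ u])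

lemma UC_wt_linear:
  assumes "u \<in> UC_wt \<kappa>" "v \<in> UC_wt \<kappa>"
  shows "(\<lambda>x. a * u x + b * v x) \<in> UC_wt \<kappa>"
  unfolding UC_wt_iff
proof (intro conjI allI impI)
  show "continuous_on UNIV (\<lambda>x. a * u x + b * v x)"
    using assms by (intro continuous_intros UC_wt_continuous)
  fix \<epsilon> :: real assume "0 < \<epsilon>"
  let ?e = "\<epsilon> / (\<bar>a\<bar> + \<bar>b\<bar> + 1)"
  have "0 < ?e" using \<open>0 < \<epsilon>\<close> by (simp add: add_nonneg_pos)
  then obtain p q where p: "p \<in> Lip_b" "\<And>x. \<kappa> x * \<bar>u x - p x\<bar> \<le> ?e"
    and q: "q \<in> Lip_b" "\<And>x. \<kappa> x * \<bar>v x - q x\<bar> \<le> ?e"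
    using assms unfolding UC_wt_iff by meson
  have "\<kappa> x * \<bar>a * u x + b * v x - (a * p x + b * q x)\<bar> \<le> \<epsilon>" for x
  proof -
    have "\<bar>a * u x + b * v x - (a * p x + b * q x)\<bar> = \<bar>a * (u x - p x) + b * (v x - q x)\<bar>"
      by (simp add: algebra_simps)
    also have "\<dots> \<le> \<bar>a\<bar> * \<bar>u x - p x\<bar> + \<bar>b\<bar> * \<bar>v x - q x\<bar>"
      by (rule order_trans[OF abs_triangle_ineq]) (simp add: abs_mult)
    finally have "\<kappa> x * \<bar>a * u x + b * v x - (a * p x + b * q x)\<bar>
        \<le> \<kappa> x * (\<bar>a\<bar> * \<bar>u x - p x\<bar> + \<bar>b\<bar> * \<bar>v x - q x\<bar>)"
      using kappa_pos[of x] by (simp add: mult_left_mono)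
    also have "\<dots> = \<bar>a\<bar> * (\<kappa> x * \<bar>u x - p x\<bar>) + \<bar>b\<bar> * (\<kappa> x * \<bar>v x - q x\<bar>)"
      by (simp add: algebra_simps)
    also have "\<dots> \<le> \<bar>a\<bar> * ?e + \<bar>b\<bar> * ?e"
      by (intro add_mono mult_left_mono p q) auto
    also have "\<dots> = (\<bar>a\<bar> + \<bar>b\<bar>) * ?e" by (rule distrib_right[symmetric])
    also have "\<dots> \<le> (\<bar>a\<bar> + \<bar>b\<bar> + 1) * ?e" using \<open>0 < ?e\<close> by (intro mult_right_mono) auto
    also have "\<dots> = \<epsilon>" by (simp add: add_nonneg_pos less_imp_neq[THEN not_sym])
    finally show ?thesis .
  qed
  then show "\<exists>w\<in>Lip_b. \<forall>x. \<kappa> x * \<bar>a * u x + b * v x - w x\<bar> \<le> \<epsilon>"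
    using Lip_b_linear[OF p(1) q(1)] by (intro bexI[of _ "\<lambda>x. a * p x + b * q x"]) auto
qed

lemma UC_wt_pos_part:
  assumes "u \<in> UC_wt \<kappa>"
  shows "(\<lambda>x. max 0 (u x)) \<in> UC_wt \<kappa>"
  unfolding UC_wt_iff
proof (intro conjI allI impI)
  show "continuous_on UNIV (\<lambda>x. max 0 (u x))"
    using assms by (intro continuous_intros UC_wt_continuous)
  fix \<epsilon> :: real assume "0 < \<epsilon>"
  then obtain p where p: "p \<in> Lip_b" "\<And>x. \<kappa> x * \<bar>u x - p x\<bar> \<le> \<epsilon>"
    using assms unfolding UC_wt_iff by meson
  have "\<kappa> x * \<bar>max 0 (u x) - max 0 (p x)\<bar> \<le> \<epsilon>" for x
    by (rule order_trans[OF _ p(2)[of x]]) (use kappa_pos[of x] in \<open>auto intro!: mult_left_mono\<close>)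
  then show "\<exists>w\<in>Lip_b. \<forall>x. \<kappa> x * \<bar>max 0 (u x) - w x\<bar> \<le> \<epsilon>"
    using Lip_b_pos_part[OF p(1)] by (intro bexI[of _ "\<lambda>x. max 0 (p x)"]) auto
qed

text \<open>
  Convergence in the weighted norm implies pointwise convergence, since the weight does not vanish;
  so the limit that defines the generator is unique.
\<close>

lemma generator_eq:
  assumes "has_generator_value \<kappa> T u v"
  shows "generator \<kappa> T u = v"
  unfolding generator_def
proof (rule the_equality)
  show "has_generator_value \<kappa> T u v" by (rule assms)
  have lim: "((\<lambda>h. (T h u y - u y) / h) \<longlongrightarrow> w y) (at_right 0)"
    if w: "has_generator_value \<kappa> T u w" for w y
  proof (rule tendstoI)
    fix e :: real assume "0 < e"
    then have "0 < ereal (\<kappa> y * e / 2)" using kappa_pos[of y] by simp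
    with w have "\<forall>\<^sub>F h in at_right 0. wnorm \<kappa> (\<lambda>x. (T h u x - u x) / h - w x) < ereal (\<kappa> y * e / 2)"
      unfolding has_generator_value_def using order_tendstoD(2) by blast
    then show "\<forall>\<^sub>F h in at_right 0. dist ((T h u y - u y) / h) (w y) < e"
    proof eventually_elim
      case (elim h)
      have "\<kappa> y * \<bar>(T h u y - u y) / h - w y\<bar> \<le> \<kappa> y * (e / 2)"
        using wnorm_lessD[OF elim, of y] by simp
      then have "\<bar>(T h u y - u y) / h - w y\<bar> \<le> e / 2" using kappa_pos[of y] by simp
      then show ?case using \<open>0 < e\<close> by (simp add: dist_real_def)
    qed
  qed
  fix w assume "has_generator_value \<kappa> T u w"
  then show "w = v" using lim assms by (intro ext) (meson tendsto_unique trivial_limit_at_right_real)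
qed

end

section \<open>Operators of the family\<close>

locale lipschitz_semigroup_family = bounded_weight \<kappa>
  for \<kappa> :: "'m::metric_space \<Rightarrow> real" +
  fixes \<Lambda> :: "'l set"
    and S :: "'l \<Rightarrow> real \<Rightarrow> ('m \<Rightarrow> real) \<Rightarrow> ('m \<Rightarrow> real)"
    and \<alpha> \<beta> :: real
  assumes Lambda_nonempty: "\<Lambda> \<noteq> {}"
    and feller: "l \<in> \<Lambda> \<Longrightarrow> feller_semigroup \<kappa> (S l)"
    and linear: "l \<in> \<Lambda> \<Longrightarrow> linear_family \<kappa> (S l)"
    and one: "l \<in> \<Lambda> \<Longrightarrow> 0 \<le> t \<Longrightarrow> S l t (\<lambda>x. 1) = (\<lambda>x. 1)"
    and wnorm_growth: "l \<in> \<Lambda> \<Longrightarrow> 0 \<le> t \<Longrightarrow> u \<in> Lip_b \<Longrightarrow>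
          wnorm \<kappa> (S l t u) \<le> ereal (exp (\<alpha> * t)) * wnorm \<kappa> u"
    and lip_growth: "l \<in> \<Lambda> \<Longrightarrow> 0 \<le> t \<Longrightarrow> u \<in> Lip_b \<Longrightarrow>
          lip_norm (S l t u) \<le> ereal (exp (\<beta> * t)) * lip_norm u"
begin

lemma S_UC_wt: "l \<in> \<Lambda> \<Longrightarrow> 0 \<le> t \<Longrightarrow> u \<in> UC_wt \<kappa> \<Longrightarrow> S l t u \<in> UC_wt \<kappa>"
  using feller unfolding feller_semigroup_def by blast

lemma S_zero: "l \<in> \<Lambda> \<Longrightarrow> u \<in> UC_wt \<kappa> \<Longrightarrow> S l 0 u = u"
  using feller unfolding feller_semigroup_def by blast

lemma S_add: "l \<in> \<Lambda> \<Longrightarrow> 0 \<le> s \<Longrightarrow> 0 \<le> t \<Longrightarrow> u \<in> UC_wt \<kappa> \<Longrightarrow> S l (s + t) u = S l s (S l t u)"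
  using feller unfolding feller_semigroup_def by blast

lemma S_mono:
  "l \<in> \<Lambda> \<Longrightarrow> 0 \<le> t \<Longrightarrow> u \<in> UC_wt \<kappa> \<Longrightarrow> v \<in> UC_wt \<kappa> \<Longrightarrow> (\<And>x. u x \<le> v x) \<Longrightarrow> S l t u x \<le> S l t v x"
  using feller unfolding feller_semigroup_def by blast

lemma S_continuous: "l \<in> \<Lambda> \<Longrightarrow> 0 \<le> t \<Longrightarrow> wnorm_continuous \<kappa> (S l t)"
  using feller unfolding feller_semigroup_def by blast

lemma S_linear:
  "l \<in> \<Lambda> \<Longrightarrow> 0 \<le> t \<Longrightarrow> u \<in> UC_wt \<kappa> \<Longrightarrow> v \<in> UC_wt \<kappa> \<Longrightarrow>
    S l t (\<lambda>x. a * u x + b * v x) = (\<lambda>x. a * S l t u x + b * S l t v x)"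
  using linear unfolding linear_family_def by blast

lemma const_UC_wt: "(\<lambda>x. c) \<in> UC_wt \<kappa>"
  by (intro Lip_b_subset_UC_wt Lip_b_const)

lemma S_const:
  assumes "l \<in> \<Lambda>" "0 \<le> t"
  shows "S l t (\<lambda>x. c) = (\<lambda>x. c)"
  using S_linear[OF assms const_UC_wt const_UC_wt, of c 1 0 0] one[OF assms] by simp

lemma S_diff:
  assumes "l \<in> \<Lambda>" "0 \<le> t" "u \<in> UC_wt \<kappa>" "v \<in> UC_wt \<kappa>"
  shows "S l t (\<lambda>x. u x - v x) = (\<lambda>x. S l t u x - S l t v x)"
  using S_linear[OF assms, of 1 "-1"] by simp

lemma UC_wt_diff:
  assumes "u \<in> UC_wt \<kappa>" "v \<in> UC_wt \<kappa>"
  shows "(\<lambda>x. u x - v x) \<in> UC_wt \<kappa>"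
  using UC_wt_linear[OF assms, of 1 "-1"] by simp

text \<open>
  The growth bound extends from \<^term>\<open>Lip_b\<close> to its closure by density and continuity of the
  operator. It has to hold there because neither the test functions nor the errors measured
  against them need to be Lipschitz.
\<close>

lemma S_growth:
  assumes l: "l \<in> \<Lambda>" and t: "0 \<le> t" and u: "u \<in> UC_wt \<kappa>"
    and c: "\<And>x. \<kappa> x * \<bar>u x\<bar> \<le> c"
  shows "\<kappa> x * \<bar>S l t u x\<bar> \<le> exp (\<alpha> * t) * c"
proof (rule field_le_epsilon)
  fix e :: real assume "0 < e"
  let ?E = "exp (\<alpha> * t)"
  define \<epsilon> where "\<epsilon> = e / (?E + 1)"
  have \<epsilon>: "0 < \<epsilon>" "(?E + 1) * \<epsilon> = e"
    using \<open>0 < e\<close> by (auto simp: \<epsilon>_def add_pos_pos add_nonneg_pos less_imp_neq[THEN not_sym])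
  obtain d where d: "0 < d"
    "\<And>v. v \<in> UC_wt \<kappa> \<Longrightarrow> wnorm \<kappa> (\<lambda>x. v x - u x) < ereal d \<Longrightarrow>
        wnorm \<kappa> (\<lambda>x. S l t v x - S l t u x) < ereal \<epsilon>"
    using S_continuous[OF l t] u \<epsilon>(1) unfolding wnorm_continuous_def by meson
  have "0 < min \<epsilon> (d / 2)" using d(1) \<epsilon>(1) by simp
  then obtain v where v: "v \<in> Lip_b" "\<And>x. \<kappa> x * \<bar>u x - v x\<bar> \<le> min \<epsilon> (d / 2)"
    using u unfolding UC_wt_iff by meson
  have "\<kappa> x * \<bar>v x - u x\<bar> \<le> d / 2" for x using v(2)[of x] by (simp add: abs_minus_commute)
  then have "wnorm \<kappa> (\<lambda>x. v x - u x) < ereal d" by (rule wnorm_lessI) (use d(1) in simp)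
  then have Sv: "\<kappa> x * \<bar>S l t v x - S l t u x\<bar> \<le> \<epsilon>"
    using d(2) Lip_b_subset_UC_wt[OF v(1)] wnorm_lessD by blast
  have "\<kappa> x * \<bar>v x\<bar> \<le> c + \<epsilon>" for x
  proof -
    have "\<kappa> x * \<bar>v x\<bar> \<le> \<kappa> x * (\<bar>u x\<bar> + \<bar>u x - v x\<bar>)"
      using kappa_pos[of x] by (intro mult_left_mono) auto
    then show ?thesis using v(2)[of x] c[of x] by (simp add: distrib_left)
  qed
  then have "wnorm \<kappa> v \<le> ereal (c + \<epsilon>)" by (simp add: wnorm_le_iff)
  then have "ereal ?E * wnorm \<kappa> v \<le> ereal ?E * ereal (c + \<epsilon>)"
    by (rule ereal_mult_left_mono) simp
  then have "wnorm \<kappa> (S l t v) \<le> ereal (?E * (c + \<epsilon>))"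
    using wnorm_growth[OF l t v(1)] by (simp add: order_trans)
  then have "\<kappa> x * \<bar>S l t v x\<bar> \<le> ?E * (c + \<epsilon>)" using wnorm_le_iff by blast
  moreover have "\<kappa> x * \<bar>S l t u x\<bar> \<le> \<kappa> x * (\<bar>S l t v x\<bar> + \<bar>S l t v x - S l t u x\<bar>)"
    using kappa_pos[of x] by (intro mult_left_mono) auto
  ultimately have "\<kappa> x * \<bar>S l t u x\<bar> \<le> ?E * (c + \<epsilon>) + \<epsilon>"
    using Sv by (simp add: distrib_left)
  also have "\<dots> = ?E * c + e" using \<epsilon>(2) by (simp add: algebra_simps)
  finally show "\<kappa> x * \<bar>S l t u x\<bar> \<le> ?E * c + e" .
qed

text \<open>
  Telescoping: \<open>S l (n s) u - u\<close> is the sum over \<open>k < n\<close> of \<open>S l (k s)\<close> applied to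
  \<open>S l s u - u\<close>, and each summand is controlled by the growth bound. The absolute value of \<open>\<alpha>\<close>
  makes the exponential monotone in time, so that one factor serves all summands.
\<close>

lemma S_iterate_deviation:
  assumes l: "l \<in> \<Lambda>" and s: "0 \<le> s" and u: "u \<in> UC_wt \<kappa>"
    and c: "\<And>x. \<kappa> x * \<bar>S l s u x - u x\<bar> \<le> c"
  shows "\<kappa> x * \<bar>S l (real n * s) u x - u x\<bar> \<le> real n * (exp (\<bar>\<alpha>\<bar> * (real n * s)) * c)"
proof (induction n arbitrary: x)
  case 0
  then show ?case using S_zero[OF l u] by simp
next
  case (Suc n)
  let ?t = "real n * s" and ?t' = "real (Suc n) * s"
  have t: "0 \<le> ?t" using s by simp
  have c0: "0 \<le> c" using c[of x] kappa_pos[of x] by (meson abs_ge_zero less_imp_le mult_nonneg_nonneg order_trans)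
  have tt: "?t \<le> ?t'" using s by (simp add: algebra_simps)
  have "\<alpha> * ?t \<le> \<bar>\<alpha>\<bar> * ?t'"
    by (rule mult_mono[OF abs_ge_self tt abs_ge_zero t])
  then have e1: "exp (\<alpha> * ?t) * c \<le> exp (\<bar>\<alpha>\<bar> * ?t') * c"
    using c0 by (simp add: mult_right_mono)
  have "\<bar>\<alpha>\<bar> * ?t \<le> \<bar>\<alpha>\<bar> * ?t'" using tt by (simp add: mult_left_mono)
  then have e2: "real n * (exp (\<bar>\<alpha>\<bar> * ?t) * c) \<le> real n * (exp (\<bar>\<alpha>\<bar> * ?t') * c)"
    using c0 by (intro mult_left_mono mult_right_mono) auto
  have "S l ?t' u = S l ?t (S l s u)"
    using S_add[OF l t s u] by (simp add: algebra_simps)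
  then have eq: "S l ?t' u x - u x = S l ?t (\<lambda>x. S l s u x - u x) x + (S l ?t u x - u x)"
    using S_diff[OF l t S_UC_wt[OF l s u] u] by simp
  have "\<kappa> x * \<bar>S l ?t (\<lambda>x. S l s u x - u x) x\<bar> \<le> exp (\<alpha> * ?t) * c"
    by (rule S_growth[OF l t UC_wt_diff[OF S_UC_wt[OF l s u] u] c])
  moreover have "\<kappa> x * \<bar>S l ?t' u x - u x\<bar>
      \<le> \<kappa> x * (\<bar>S l ?t (\<lambda>x. S l s u x - u x) x\<bar> + \<bar>S l ?t u x - u x\<bar>)"
    unfolding eq using kappa_pos[of x] by (intro mult_left_mono) auto
  ultimately have "\<kappa> x * \<bar>S l ?t' u x - u x\<bar>
      \<le> exp (\<bar>\<alpha>\<bar> * ?t') * c + real n * (exp (\<bar>\<alpha>\<bar> * ?t') * c)"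
    using Suc.IH[of x] e1 e2 by (simp add: distrib_left)
  then show ?case by (simp add: algebra_simps)
qed

text \<open>
  This replaces the integral formula \<open>S l h u - u = \<integral> S l s (A u) ds\<close> over \<open>[0, h]\<close>: cut
  \<open>[0, h]\<close> into \<open>n\<close> steps so short that the difference quotient of one step has norm at most
  \<open>\<delta>\<close>, and telescope. The strict bound on the generator leaves room for this.
\<close>

lemma S_deviation:
  assumes l: "l \<in> \<Lambda>" and h: "0 \<le> h" and u: "u \<in> gen_domain \<kappa> (S l)"
    and \<delta>: "wnorm \<kappa> (generator \<kappa> (S l) u) < ereal \<delta>"
  shows "\<kappa> x * \<bar>S l h u x - u x\<bar> \<le> \<delta> * h * exp (\<bar>\<alpha>\<bar> * h)"
proof (cases "h = 0")
  case True
  then show ?thesis using S_zero[OF l] u by (simp add: gen_domain_def)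
next
  case False
  then have h: "0 < h" using \<open>0 \<le> h\<close> by simp
  obtain v where v: "has_generator_value \<kappa> (S l) u v" and uUC: "u \<in> UC_wt \<kappa>"
    using u unfolding gen_domain_def by auto
  have "wnorm \<kappa> v < ereal \<delta>" using \<delta> generator_eq[OF v] by simp
  then obtain \<gamma>' where "wnorm \<kappa> v < \<gamma>'" "\<gamma>' < ereal \<delta>" using dense by blast
  moreover have "0 \<le> wnorm \<kappa> v" unfolding wnorm_def sup_norm_def by (rule SUP_upper2) auto
  ultimately obtain \<gamma> where \<gamma>: "wnorm \<kappa> v < ereal \<gamma>" "\<gamma> < \<delta>"
    by (cases \<gamma>') auto
  have "0 < ereal (\<delta> - \<gamma>)" using \<gamma>(2) by simp
  with v have "\<forall>\<^sub>F s in at_right 0. wnorm \<kappa> (\<lambda>x. (S l s u x - u x) / s - v x) < ereal (\<delta> - \<gamma>)"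
    unfolding has_generator_value_def using order_tendstoD(2) by blast
  then obtain b where b: "0 < b"
    "\<And>s. 0 < s \<Longrightarrow> s < b \<Longrightarrow> wnorm \<kappa> (\<lambda>x. (S l s u x - u x) / s - v x) < ereal (\<delta> - \<gamma>)"
    unfolding eventually_at_right_field by auto
  \<comment> \<open>so many steps that one of them is shorter than \<open>b\<close>\<close>
  obtain n where n: "h / b < real n" using reals_Archimedean2 by blast
  have "0 < h / b" using h b by simp
  then have n0: "0 < real n" using n by linarith
  define s where "s = h / real n"
  have s: "0 < s" "s < b" "real n * s = h"
    using h b n n0 by (auto simp: s_def field_simps)
  have "\<kappa> y * \<bar>S l s u y - u y\<bar> \<le> s * \<delta>" for y
  proof -
    have "\<bar>(S l s u y - u y) / s\<bar> \<le> \<bar>(S l s u y - u y) / s - v y\<bar> + \<bar>v y\<bar>" by simp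
    then have "\<kappa> y * \<bar>(S l s u y - u y) / s\<bar> \<le> \<kappa> y * (\<bar>(S l s u y - u y) / s - v y\<bar> + \<bar>v y\<bar>)"
      using kappa_pos[of y] by (intro mult_left_mono) auto
    also have "\<dots> \<le> (\<delta> - \<gamma>) + \<gamma>"
      using wnorm_lessD[OF b(2)[OF s(1,2)], of y] wnorm_lessD[OF \<gamma>(1), of y]
      by (simp add: distrib_left)
    finally show ?thesis using s(1) by (simp add: abs_div field_simps)
  qed
  from S_iterate_deviation[OF l less_imp_le[OF s(1)] uUC this, where n = n and x = x]
  have "\<kappa> x * \<bar>S l h u x - u x\<bar> \<le> real n * (exp (\<bar>\<alpha>\<bar> * h) * (s * \<delta>))" by (simp add: s(3))
  also have "\<dots> = \<delta> * (real n * s) * exp (\<bar>\<alpha>\<bar> * h)" by simp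
  finally show ?thesis by (simp add: s(3))
qed

section \<open>The one-step supremum and its iterates\<close>

lemma S_between:
  assumes "l \<in> \<Lambda>" "0 \<le> t" "u \<in> UC_wt \<kappa>" "\<And>x. a \<le> u x" "\<And>x. u x \<le> b"
  shows "a \<le> S l t u x" "S l t u x \<le> b"
  using S_mono[OF assms(1,2) const_UC_wt assms(3,4), of x]
    S_mono[OF assms(1,2,3) const_UC_wt assms(5), of x]
  by (simp_all add: S_const[OF assms(1,2)])

lemma bdd_above_S:
  assumes "0 \<le> t" "u \<in> Lip_b"
  shows "bdd_above ((\<lambda>l. S l t u x) ` \<Lambda>)"
proof -
  obtain C where C: "\<And>x. \<bar>u x\<bar> \<le> C" using Lip_b_bound assms by metis
  have "S l t u x \<le> C" if "l \<in> \<Lambda>" for l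
    by (rule S_between(2)[OF that assms(1) Lip_b_subset_UC_wt[OF assms(2)], of "-C"])
      (use C in \<open>auto simp: abs_le_iff minus_le_iff\<close>)
  then show ?thesis by (rule bdd_aboveI2)
qed

lemma S_le_sup_op:
  "0 \<le> t \<Longrightarrow> u \<in> Lip_b \<Longrightarrow> l \<in> \<Lambda> \<Longrightarrow> S l t u x \<le> sup_op \<Lambda> S t u x"
  unfolding sup_op_def by (intro cSUP_upper bdd_above_S)

lemma sup_op_least:
  "(\<And>l. l \<in> \<Lambda> \<Longrightarrow> S l t u x \<le> c) \<Longrightarrow> sup_op \<Lambda> S t u x \<le> c"
  unfolding sup_op_def by (intro cSUP_least Lambda_nonempty)

lemma sup_op_between:
  assumes t: "0 \<le> t" and u: "u \<in> Lip_b" and a: "\<And>x. a \<le> u x" and b: "\<And>x. u x \<le> b"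
  shows "a \<le> sup_op \<Lambda> S t u x" "sup_op \<Lambda> S t u x \<le> b"
proof -
  obtain l where "l \<in> \<Lambda>" using Lambda_nonempty by blast
  then show "a \<le> sup_op \<Lambda> S t u x"
    using S_between(1)[OF _ t Lip_b_subset_UC_wt[OF u] a b] S_le_sup_op[OF t u] order_trans by meson
  show "sup_op \<Lambda> S t u x \<le> b"
    by (rule sup_op_least) (rule S_between(2)[OF _ t Lip_b_subset_UC_wt[OF u] a b])
qed

lemma sup_op_mono:
  assumes t: "0 \<le> t" and u: "u \<in> Lip_b" and v: "v \<in> Lip_b" and le: "\<And>x. u x \<le> v x"
  shows "sup_op \<Lambda> S t u x \<le> sup_op \<Lambda> S t v x"
proof (rule sup_op_least)
  fix l assume l: "l \<in> \<Lambda>"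
  show "S l t u x \<le> sup_op \<Lambda> S t v x"
    using S_mono[OF l t Lip_b_subset_UC_wt[OF u] Lip_b_subset_UC_wt[OF v] le]
      S_le_sup_op[OF t v l] by (rule order_trans)
qed

text \<open>
  The Lipschitz bounds of the members of the family are uniform, hence inherited by their supremum.
  The extra 1 in the constant is there because the Lipschitz norm is an infimum over constants.
\<close>

lemma sup_op_Lip_b:
  assumes t: "0 \<le> t" and u: "u \<in> Lip_b"
  shows "sup_op \<Lambda> S t u \<in> Lip_b"
proof -
  obtain C where C: "\<And>x. \<bar>u x\<bar> \<le> C" using Lip_b_bound u by metis
  obtain L where L: "0 \<le> L" "L-lipschitz_on UNIV u" using Lip_b_lipschitz u by metis
  let ?L = "exp (\<beta> * t) * L + 1"
  have "lip_norm u \<le> ereal L" unfolding lip_norm_def using L by (intro INF_lower) auto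
  then have le: "ereal (exp (\<beta> * t)) * lip_norm u \<le> ereal (exp (\<beta> * t)) * ereal L"
    by (rule ereal_mult_left_mono) simp
  have lip: "?L-lipschitz_on UNIV (S l t u)" if l: "l \<in> \<Lambda>" for l
  proof (rule lipschitz_on_lip_norm_less)
    have "lip_norm (S l t u) \<le> ereal (exp (\<beta> * t) * L)"
      using order_trans[OF lip_growth[OF l t u] le] by simp
    also have "\<dots> < ereal ?L" by simp
    finally show "lip_norm (S l t u) < ereal ?L" .
  qed
  have le: "sup_op \<Lambda> S t u x \<le> sup_op \<Lambda> S t u y + ?L * dist x y" for x y
  proof (rule sup_op_least)
    fix l assume l: "l \<in> \<Lambda>"
    have "S l t u x \<le> S l t u y + ?L * dist x y"
      using lipschitz_onD[OF lip[OF l], of x y] by (simp add: dist_real_def)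
    then show "S l t u x \<le> sup_op \<Lambda> S t u y + ?L * dist x y"
      using S_le_sup_op[OF t u l, of y] by linarith
  qed
  have "?L-lipschitz_on UNIV (sup_op \<Lambda> S t u)"
  proof (rule lipschitz_onI)
    show "0 \<le> ?L" using L(1) by simp
    fix x y show "dist (sup_op \<Lambda> S t u x) (sup_op \<Lambda> S t u y) \<le> ?L * dist x y"
      using le[of x y] le[of y x] by (simp add: dist_real_def dist_commute abs_le_iff)
  qed
  moreover have "\<bar>sup_op \<Lambda> S t u x\<bar> \<le> C" for x
  proof -
    have "-C \<le> u y" "u y \<le> C" for y using C[of y] by linarith+
    from sup_op_between[OF t u this, of x] show ?thesis by linarith
  qed
  ultimately show ?thesis by (rule Lip_bI[rotated])
qed

abbreviation iterate :: "real list \<Rightarrow> ('m \<Rightarrow> real) \<Rightarrow> ('m \<Rightarrow> real)" where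
  "iterate \<equiv> compose_along (sup_op \<Lambda> S)"

lemma iterate_Lip_b: "sorted ts \<Longrightarrow> u \<in> Lip_b \<Longrightarrow> iterate ts u \<in> Lip_b"
  by (induction "sup_op \<Lambda> S" ts u rule: compose_along.induct) (auto intro: sup_op_Lip_b)

lemma iterate_between:
  assumes "sorted ts" "u \<in> Lip_b" "\<And>x. a \<le> u x" "\<And>x. u x \<le> b"
  shows "a \<le> iterate ts u x \<and> iterate ts u x \<le> b"
  using assms
proof (induction "sup_op \<Lambda> S" ts u arbitrary: x rule: compose_along.induct)
  case (1 s t ts u)
  then have "0 \<le> t - s" "iterate (t # ts) u \<in> Lip_b" by (auto intro: iterate_Lip_b)
  with 1 show ?case by (auto intro!: sup_op_between)
qed auto

lemma iterate_mono:
  assumes "sorted ts" "u \<in> Lip_b" "v \<in> Lip_b" "\<And>x. u x \<le> v x"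
  shows "iterate ts u x \<le> iterate ts v x"
  using assms
proof (induction ts arbitrary: x rule: induct_list012)
  case (3 s t ts)
  then have "0 \<le> t - s" "iterate (t # ts) u \<in> Lip_b" "iterate (t # ts) v \<in> Lip_b"
    by (auto intro: iterate_Lip_b)
  with 3 show ?case by (auto intro!: sup_op_mono)
qed auto

text \<open>
  Induction along the partition. Let \<open>g\<close> be the result of the later steps and suppose that \<open>g\<close>
  exceeds \<open>w\<close> by at most \<open>c / \<kappa>\<close>. The function \<open>c / \<kappa>\<close> itself need not be in the domain of the
  semigroups, so the excess is carried by \<open>f\<close>, the positive part of \<open>g - w\<close>: one has
  \<open>g \<le> w + f\<close>, the weighted norm of \<open>f\<close> is at most \<open>c\<close>, and \<open>S l h f\<close> obeys the growth bound. The
  new error is the old one, enlarged by \<open>exp (\<bar>\<alpha>\<bar> h)\<close>, plus that of one step for \<open>w\<close>.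
\<close>

lemma iterate_deviation:
  assumes w: "w \<in> UC_wt \<kappa>" and B: "0 \<le> B"
    and step: "\<And>l h x. l \<in> \<Lambda> \<Longrightarrow> 0 \<le> h \<Longrightarrow> \<kappa> x * (S l h w x - w x) \<le> B * h * exp (\<bar>\<alpha>\<bar> * h)"
    and u: "u \<in> Lip_b" and le: "\<And>x. u x \<le> w x"
    and "sorted ts" "ts \<noteq> []"
  shows "\<kappa> x * (iterate ts u x - w x)
      \<le> B * (last ts - hd ts) * exp (\<bar>\<alpha>\<bar> * (last ts - hd ts))"
  using \<open>sorted ts\<close> \<open>ts \<noteq> []\<close>
proof (induction ts arbitrary: x rule: induct_list012)
  case 1
  then show ?case by simp
next
  case (2 s)
  show ?case using le[of x] kappa_pos[of x] by (simp add: mult_nonneg_nonpos)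
next
  case (3 s t ts)
  define g where "g = iterate (t # ts) u"
  define f where "f = (\<lambda>x. max 0 (g x - w x))"
  define h r where "h = t - s" and "r = last (t # ts) - t"
  define c where "c = B * r * exp (\<bar>\<alpha>\<bar> * r)"
  have h: "0 \<le> h" using 3 by (simp add: h_def)
  have r: "0 \<le> r" using 3 by (auto simp: r_def last_conv_nth)
  have c: "0 \<le> c" using B r by (simp add: c_def)
  have g: "g \<in> Lip_b" using 3 u by (auto simp: g_def intro: iterate_Lip_b)
  have gUC: "g \<in> UC_wt \<kappa>" using Lip_b_subset_UC_wt g .
  have f: "f \<in> UC_wt \<kappa>" unfolding f_def by (intro UC_wt_pos_part UC_wt_diff gUC w)
  have fc: "\<kappa> y * \<bar>f y\<bar> \<le> c" for y
  proof -
    have "\<kappa> y * (g y - w y) \<le> c" using 3 unfolding g_def c_def r_def by simp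
    then show ?thesis using c by (auto simp: f_def max_def)
  qed
  have "S l h g x \<le> w x + (exp (\<bar>\<alpha>\<bar> * h) * c + B * h * exp (\<bar>\<alpha>\<bar> * h)) / \<kappa> x" if l: "l \<in> \<Lambda>" for l
  proof -
    have wf: "(\<lambda>x. 1 * w x + 1 * f x) \<in> UC_wt \<kappa>" by (rule UC_wt_linear[OF w f])
    have "S l h g x \<le> S l h (\<lambda>x. 1 * w x + 1 * f x) x"
      by (rule S_mono[OF l h gUC wf]) (simp add: f_def)
    also have "\<dots> = S l h w x + S l h f x" by (subst S_linear[OF l h w f]) simp
    finally have "\<kappa> x * S l h g x \<le> \<kappa> x * (S l h w x + S l h f x)"
      using kappa_pos[of x] by simp
    moreover have "\<kappa> x * S l h f x \<le> \<kappa> x * \<bar>S l h f x\<bar>" using kappa_pos[of x] by simp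
    moreover have "\<dots> \<le> exp (\<alpha> * h) * c" by (rule S_growth[OF l h f fc])
    moreover have "\<dots> \<le> exp (\<bar>\<alpha>\<bar> * h) * c" using c h by (auto intro!: mult_right_mono)
    ultimately have "\<kappa> x * S l h g x \<le> \<kappa> x * w x + (exp (\<bar>\<alpha>\<bar> * h) * c + B * h * exp (\<bar>\<alpha>\<bar> * h))"
      using step[OF l h, of x] by (simp add: algebra_simps)
    then show ?thesis using kappa_pos[of x] by (simp add: field_simps)
  qed
  then have "sup_op \<Lambda> S h g x \<le> w x + (exp (\<bar>\<alpha>\<bar> * h) * c + B * h * exp (\<bar>\<alpha>\<bar> * h)) / \<kappa> x"
    by (rule sup_op_least)
  then have "\<kappa> x * (sup_op \<Lambda> S h g x - w x) \<le> exp (\<bar>\<alpha>\<bar> * h) * c + B * h * exp (\<bar>\<alpha>\<bar> * h)"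
    using kappa_pos[of x] by (simp add: field_simps)
  also have "\<dots> \<le> B * r * exp (\<bar>\<alpha>\<bar> * (h + r)) + B * h * exp (\<bar>\<alpha>\<bar> * (h + r))"
  proof (rule add_mono)
    show "exp (\<bar>\<alpha>\<bar> * h) * c \<le> B * r * exp (\<bar>\<alpha>\<bar> * (h + r))"
      by (simp add: c_def distrib_left exp_add)
    show "B * h * exp (\<bar>\<alpha>\<bar> * h) \<le> B * h * exp (\<bar>\<alpha>\<bar> * (h + r))"
      using B h r by (intro mult_left_mono) (auto intro!: mult_left_mono)
  qed
  also have "\<dots> = B * (h + r) * exp (\<bar>\<alpha>\<bar> * (h + r))" by (simp add: algebra_simps)
  also have "h + r = last (s # t # ts) - hd (s # t # ts)" by (simp add: h_def r_def)
  finally show ?case by (simp add: g_def h_def)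
qed

section \<open>The semigroup envelope\<close>

lemma partition_list:
  assumes "\<pi> \<in> partitions t"
  shows "sorted (sorted_list_of_set \<pi>)" "sorted_list_of_set \<pi> \<noteq> []"
    "hd (sorted_list_of_set \<pi>) = 0" "last (sorted_list_of_set \<pi>) = t"
proof -
  have \<pi>: "finite \<pi>" "\<pi> \<subseteq> {0..}" "0 \<in> \<pi>" "Max \<pi> = t" using assms by (auto simp: partitions_def)
  let ?ts = "sorted_list_of_set \<pi>"
  show s: "sorted ?ts" by simp
  have set: "set ?ts = \<pi>" using \<pi> by simp
  show ne: "?ts \<noteq> []" using \<pi> set by auto
  have "hd ?ts \<le> 0"
    using s ne set \<pi>(3) by (metis hd_Cons_tl list.set_intros(1) order_refl set_ConsD sorted_simps(2))
  moreover have "hd ?ts \<in> \<pi>" using ne set hd_in_set by blast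
  ultimately show "hd ?ts = 0" using \<pi>(2) by force
  show "last ?ts = t"
  proof (rule antisym)
    show "last ?ts \<le> t" using \<pi> ne set by (metis Max_ge last_in_set)
    have "t \<in> set ?ts" using \<pi> set by (metis Max_in empty_iff)
    then show "t \<le> last ?ts"
      using s ne by (metis append_butlast_last_id in_set_conv_decomp sorted_append Un_iff set_append
          set_ConsD empty_iff empty_set list.set_intros(1) order_refl)
  qed
qed

lemma partitions_nonempty: "0 \<le> t \<Longrightarrow> partitions t \<noteq> {}"
  by (auto simp: partitions_def intro!: exI[of _ "{0, t}"])

lemma partition_op_le_envelope:
  assumes "u \<in> Lip_b" "\<pi> \<in> partitions t"
  shows "partition_op \<Lambda> S \<pi> u x \<le> semigroup_envelope \<Lambda> S t u x"
proof -
  obtain C where C: "\<And>x. \<bar>u x\<bar> \<le> C" using Lip_b_bound assms by metis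
  then have "-C \<le> u y" "u y \<le> C" for y by (auto simp: abs_le_iff minus_le_iff)
  then have "partition_op \<Lambda> S \<rho> u x \<le> C" if "\<rho> \<in> partitions t" for \<rho>
    using iterate_between[OF partition_list(1)[OF that] assms(1)] unfolding partition_op_def by blast
  then show ?thesis unfolding semigroup_envelope_def
    by (intro cSUP_upper assms(2) bdd_aboveI2[where M = C])
qed

lemma envelope_least:
  "0 \<le> t \<Longrightarrow> (\<And>\<pi>. \<pi> \<in> partitions t \<Longrightarrow> partition_op \<Lambda> S \<pi> u x \<le> c) \<Longrightarrow>
    semigroup_envelope \<Lambda> S t u x \<le> c"
  unfolding semigroup_envelope_def by (intro cSUP_least partitions_nonempty)

lemma envelope_nonneg:
  assumes "0 \<le> t" "u \<in> Lip_b" "\<And>x. 0 \<le> u x"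
  shows "0 \<le> semigroup_envelope \<Lambda> S t u x"
proof -
  obtain \<pi> where \<pi>: "\<pi> \<in> partitions t" using partitions_nonempty assms(1) by blast
  obtain C where C: "\<And>x. \<bar>u x\<bar> \<le> C" using Lip_b_bound assms by metis
  then have "u y \<le> C" for y by (auto simp: abs_le_iff)
  then have "0 \<le> partition_op \<Lambda> S \<pi> u x"
    using iterate_between[OF partition_list(1)[OF \<pi>] assms(2,3)] unfolding partition_op_def by blast
  then show ?thesis using partition_op_le_envelope[OF assms(2) \<pi>] by (rule order_trans)
qed

lemma envelope_mono:
  assumes "0 \<le> t" "u \<in> Lip_b" "v \<in> Lip_b" "\<And>x. u x \<le> v x"
  shows "semigroup_envelope \<Lambda> S t u x \<le> semigroup_envelope \<Lambda> S t v x"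
proof (rule envelope_least[OF assms(1)])
  fix \<pi> assume \<pi>: "\<pi> \<in> partitions t"
  show "partition_op \<Lambda> S \<pi> u x \<le> semigroup_envelope \<Lambda> S t v x"
    using iterate_mono[OF partition_list(1)[OF \<pi>] assms(2-4), of x]
      partition_op_le_envelope[OF assms(3) \<pi>, of x] unfolding partition_op_def by linarith
qed

lemma envelope_le_barrier:
  assumes "0 \<le> t" and "w \<in> UC_wt \<kappa>" and "0 \<le> B"
    and "\<And>l h x. l \<in> \<Lambda> \<Longrightarrow> 0 \<le> h \<Longrightarrow> \<kappa> x * (S l h w x - w x) \<le> B * h * exp (\<bar>\<alpha>\<bar> * h)"
    and "u \<in> Lip_b" and "\<And>x. u x \<le> w x"
  shows "semigroup_envelope \<Lambda> S t u x \<le> w x + B * t * exp (\<bar>\<alpha>\<bar> * t) / \<kappa> x"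
proof (rule envelope_least[OF assms(1)])
  fix \<pi> assume \<pi>: "\<pi> \<in> partitions t"
  show "partition_op \<Lambda> S \<pi> u x \<le> w x + B * t * exp (\<bar>\<alpha>\<bar> * t) / \<kappa> x"
    using iterate_deviation[OF assms(2-6) partition_list(1,2)[OF \<pi>], of x]
      kappa_pos[of x] partition_list(3,4)[OF \<pi>]
    unfolding partition_op_def by (simp add: field_simps)
qed

text \<open>
  A barrier \<open>b - a \<phi>\<close> moves like \<open>\<phi>\<close> because constants are invariant. The factor 2 turns the weak
  bound on the generator into the strict one that \<open>S_deviation\<close> asks for.
\<close>

lemma test_function_deviation:
  assumes l: "l \<in> \<Lambda>" and h: "0 \<le> h" and a: "0 \<le> a" and \<delta>: "0 < \<delta>"
    and \<phi>: "\<phi> \<in> gen_domain \<kappa> (S l)" "wnorm \<kappa> (generator \<kappa> (S l) \<phi>) \<le> ereal \<delta>"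
    and w: "w = (\<lambda>y. b - a * \<phi> y)"
  shows "\<kappa> x * (S l h w x - w x) \<le> (2 * a * \<delta>) * h * exp (\<bar>\<alpha>\<bar> * h)"
proof -
  have UC: "\<phi> \<in> UC_wt \<kappa>" using \<phi>(1) by (simp add: gen_domain_def)
  have w': "w = (\<lambda>y. b * 1 + (- a) * \<phi> y)" using w by simp
  have wx: "w x = b - a * \<phi> x" by (simp add: w)
  have Sw: "S l h w x = b - a * S l h \<phi> x"
    unfolding w' by (subst S_linear[OF l h const_UC_wt UC]) (simp add: one[OF l h])
  then have "\<kappa> x * (S l h w x - w x) = - a * (\<kappa> x * (S l h \<phi> x - \<phi> x))"
    unfolding Sw wx by (simp add: algebra_simps)
  also have "\<dots> \<le> a * (\<kappa> x * \<bar>S l h \<phi> x - \<phi> x\<bar>)"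
  proof -
    have "- (\<kappa> x * (S l h \<phi> x - \<phi> x)) \<le> \<kappa> x * \<bar>S l h \<phi> x - \<phi> x\<bar>"
      using kappa_pos[of x] by (simp flip: mult_minus_right)
    from mult_left_mono[OF this a] show ?thesis by simp
  qed
  also have "\<dots> \<le> a * (2 * \<delta> * h * exp (\<bar>\<alpha>\<bar> * h))"
    by (rule mult_left_mono[OF S_deviation[OF l h \<phi>(1)] a])
      (use \<phi>(2) \<delta> in \<open>auto elim!: le_less_trans\<close>)
  finally show ?thesis by simp
qed

end

theorem proposition5p4:
  fixes \<kappa> :: "'m::metric_space \<Rightarrow> real"
    and \<Lambda> :: "'l set"
    and S :: "'l \<Rightarrow> real \<Rightarrow> ('m \<Rightarrow> real) \<Rightarrow> ('m \<Rightarrow> real)"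
    and \<alpha> \<beta> :: real
  assumes separable: "separable_space (euclidean :: 'm topology)"
    and Lambda_nonempty: "\<Lambda> \<noteq> {}"
    and kappa_cont: "continuous_on UNIV \<kappa>"
    and kappa_pos: "\<And>x. 0 < \<kappa> x"
    and kappa_bounded: "bounded (range \<kappa>)"
    and A1_feller: "\<And>l. l \<in> \<Lambda> \<Longrightarrow> feller_semigroup \<kappa> (S l)"
    and A1_linear: "\<And>l. l \<in> \<Lambda> \<Longrightarrow> linear_family \<kappa> (S l)"
    and A1_one: "\<And>l t. l \<in> \<Lambda> \<Longrightarrow> 0 \<le> t \<Longrightarrow> S l t (\<lambda>x. 1) = (\<lambda>x. 1)"
    and A2_wnorm: "\<And>l t u. l \<in> \<Lambda> \<Longrightarrow> 0 \<le> t \<Longrightarrow> u \<in> Lip_b \<Longrightarrow>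
          wnorm \<kappa> (S l t u) \<le> ereal (exp (\<alpha> * t)) * wnorm \<kappa> u"
    and A2_lip: "\<And>l t u. l \<in> \<Lambda> \<Longrightarrow> 0 \<le> t \<Longrightarrow> u \<in> Lip_b \<Longrightarrow>
          lip_norm (S l t u) \<le> ereal (exp (\<beta> * t)) * lip_norm u"
    and test_functions: "\<And>x \<delta>. 0 < \<delta> \<Longrightarrow>
          \<exists>\<phi>\<in>C_0. \<phi> x = 1 \<and> (\<forall>y. 0 \<le> \<phi> y \<and> \<phi> y \<le> 1) \<and>
            \<phi> \<in> (\<Inter>l\<in>\<Lambda>. gen_domain \<kappa> (S l)) \<and>
            (SUP l\<in>\<Lambda>. wnorm \<kappa> (generator \<kappa> (S l) \<phi>)) \<le> ereal \<delta>"
  shows "continuous_from_above_on Lip_b (semigroup_envelope \<Lambda> S)"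
proof -
  interpret lipschitz_semigroup_family \<kappa> \<Lambda> S \<alpha> \<beta>
    by unfold_locales (fact kappa_pos kappa_bounded Lambda_nonempty A1_feller A1_linear A1_one
        A2_wnorm A2_lip)+
  show ?thesis
    unfolding continuous_from_above_on_def
  proof (intro allI impI)
    fix t :: real and us :: "nat \<Rightarrow> 'm \<Rightarrow> real"
    assume t: "0 \<le> t" and us: "\<forall>n. us n \<in> Lip_b" and dec: "decreases_to us (\<lambda>x. 0)"
    have anti: "us n x \<le> us m x" if "m \<le> n" for m n x
      using dec that unfolding decreases_to_def decseq_def by blast
    note nonneg = decreases_to_zero_nonneg[OF dec]
    obtain C where C: "0 < C" "\<And>x. \<bar>us 0 x\<bar> \<le> C" using Lip_b_bound us by metis
    have usC: "us n x \<le> C" for n x using anti[of 0 n x] C(2)[of x] by simp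
    let ?T = "\<lambda>n. semigroup_envelope \<Lambda> S t (us n)"
    have "(\<lambda>n. ?T n x) \<longlonglongrightarrow> 0" for x
    proof (rule LIMSEQ_I)
      fix e :: real assume e: "0 < e"
      define D where "D = 4 * C * t * exp (\<bar>\<alpha>\<bar> * t) / \<kappa> x"
      have D: "0 \<le> D" unfolding D_def using C(1) t kappa_pos[of x] by simp
      \<comment> \<open>\<open>D * \<delta>\<close> will be the total error along a partition, to be kept below \<open>e / 4\<close>\<close>
      define \<delta> where "\<delta> = e / (4 * (D + 1))"
      have \<delta>: "0 < \<delta>" using e D by (simp add: \<delta>_def)
      have "D * \<delta> \<le> (D + 1) * \<delta>" using \<delta> by (simp add: distrib_right)
      also have "\<dots> = e / 4" using D by (simp add: \<delta>_def field_simps)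
      finally have D\<delta>: "D * \<delta> \<le> e / 4" .
      obtain \<phi> where \<phi>: "\<phi> \<in> C_0" "\<phi> x = 1" "\<And>y. 0 \<le> \<phi> y" "\<And>y. \<phi> y \<le> 1"
        "\<And>l. l \<in> \<Lambda> \<Longrightarrow> \<phi> \<in> gen_domain \<kappa> (S l)"
        "(SUP l\<in>\<Lambda>. wnorm \<kappa> (generator \<kappa> (S l) \<phi>)) \<le> ereal \<delta>"
        using test_functions[OF \<delta>, of x] by blast
      have gen: "wnorm \<kappa> (generator \<kappa> (S l) \<phi>) \<le> ereal \<delta>" if "l \<in> \<Lambda>" for l
        using \<phi>(6) that by (simp add: SUP_le_iff)
      have \<phi>UC: "\<phi> \<in> UC_wt \<kappa>" using \<phi>(5) Lambda_nonempty by (auto simp: gen_domain_def)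
      \<comment> \<open>the barrier \<open>e / 2 + 2 C (1 - \<phi>)\<close>\<close>
      define w where "w = (\<lambda>y. (e / 2 + 2 * C) - 2 * C * \<phi> y)"
      have w: "w \<in> UC_wt \<kappa>"
        using UC_wt_linear[OF const_UC_wt \<phi>UC, of 1 "e / 2 + 2 * C" "- (2 * C)"]
        by (simp add: w_def)
      have "compact {y. 1 / 2 \<le> \<phi> y}"
        by (rule C_0_superlevel_compact[OF \<phi>(1) UC_wt_continuous[OF \<phi>UC]]) simp
      moreover have "continuous_on UNIV (us n)" for n using us Lip_b_continuous by blast
      ultimately obtain N where N: "\<And>n y. N \<le> n \<Longrightarrow> y \<in> {y. 1 / 2 \<le> \<phi> y} \<Longrightarrow> us n y < e / 2"
        using Dini_decreasing[OF _ _ dec, of "{y. 1 / 2 \<le> \<phi> y}" "e / 2"] e by auto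
      have "norm (?T n x - 0) < e" if n: "N \<le> n" for n
      proof -
        have "us n y \<le> w y" for y
        proof (cases "1 / 2 \<le> \<phi> y")
          case True
          moreover have "2 * C * \<phi> y \<le> 2 * C" using \<phi>(4)[of y] C(1) by simp
          ultimately show ?thesis using N[OF n, of y] by (simp add: w_def)
        next
          case False
          then have "C * \<phi> y \<le> C * (1 / 2)" using C(1) by (intro mult_left_mono) auto
          then show ?thesis using usC[of n y] e by (simp add: w_def)
        qed
        then have "?T n x \<le> w x + (2 * (2 * C) * \<delta>) * t * exp (\<bar>\<alpha>\<bar> * t) / \<kappa> x"
          using C(1) \<delta> us gen \<phi>(5)
          by (intro envelope_le_barrier[OF t w] test_function_deviation[where b = "e / 2 + 2 * C"])
            (auto simp: w_def)
        also have "\<dots> = e / 2 + D * \<delta>" by (simp add: w_def \<phi>(2) D_def)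
        finally have "?T n x < e" using D\<delta> e by linarith
        moreover have "0 \<le> ?T n x" by (rule envelope_nonneg[OF t]) (use us nonneg in auto)
        ultimately show ?thesis by simp
      qed
      then show "\<exists>N. \<forall>n\<ge>N. norm (?T n x - 0) < e" by blast
    qed
    moreover have "decseq (\<lambda>n. ?T n x)" for x
      unfolding decseq_def using envelope_mono[OF t] us anti by blast
    ultimately show "decreases_to ?T (\<lambda>x. 0)" unfolding decreases_to_def by blast
  qed
qed

end
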